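(* Let $G$ be a connected graph and let $\mathcal{T}$ be a set of $t$ pairwise edge-disjoint triangles of $G$ such that the subgraph of $G$ formed by the edge set $E(\mathcal{T})=\bigcup_{T\in\mathcal{T}}E(T)$ is a triangle-forest-structure. Then $rc(L(G))\leq n_2-t$, where $n_2$ is the number of vertices of $G$ of degree at least $2$. Moreover, the bound is sharp: for every positive integer $t$ there exist a connected graph $G$ and such a set $\mathcal{T}$ of $t$ triangles with $rc(L(G))=n_2-t$.
   Context: All graphs are simple, finite and undirected. $L(G)$ is the line graph of $G$. For an edge-colouring of a graph (adjacent edges may receive the same colour), a path is rainbow if no two of its edges have the same colour; the graph is rainbow connected if every two vertices are joined by a rainbow path. The rainbow connection number $rc(H)$ of a connected graph $H$ is the smallest number of colours in an edge-colouring making $H$ rainbow connected. A triangle-tree-structure is a connected graph every block of which is a triangle ($K_3$); a triangle-forest-structure is a graph each of whose connected components is a triangle-tree-structure. *)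

theory Defs
  imports Main
begin

definition graph :: "'a set \<Rightarrow> 'a set set \<Rightarrow> bool" where
  "graph V E \<longleftrightarrow> finite V \<and> (\<forall>e\<in>E. e \<subseteq> V \<and> card e = 2)"

definition adj_in :: "'a set set \<Rightarrow> 'a set \<Rightarrow> ('a \<times> 'a) set" where
  "adj_in E S = {(u, v). u \<in> S \<and> v \<in> S \<and> {u, v} \<in> E}"

definition connected_on :: "'a set set \<Rightarrow> 'a set \<Rightarrow> bool" where
  "connected_on E S \<longleftrightarrow> S \<noteq> {} \<and> S \<times> S \<subseteq> (adj_in E S)\<^sup>*"

definition connected_graph :: "'a set \<Rightarrow> 'a set set \<Rightarrow> bool" where
  "connected_graph V E \<longleftrightarrow> graph V E \<and> connected_on E V"

definition no_cut_vertex :: "'a set set \<Rightarrow> 'a set \<Rightarrow> bool" where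
  "no_cut_vertex E S \<longleftrightarrow> (\<forall>x\<in>S. S - {x} = {} \<or> connected_on E (S - {x}))"

text \<open>Blocks: maximal connected subgraphs without a cut vertex (given by vertex sets;
  such a maximal subgraph is always induced).\<close>
definition is_block :: "'a set \<Rightarrow> 'a set set \<Rightarrow> 'a set \<Rightarrow> bool" where
  "is_block V E B \<longleftrightarrow> B \<subseteq> V \<and> connected_on E B \<and> no_cut_vertex E B \<and>
     (\<forall>B'. B \<subset> B' \<and> B' \<subseteq> V \<longrightarrow> \<not> (connected_on E B' \<and> no_cut_vertex E B'))"

definition is_component :: "'a set \<Rightarrow> 'a set set \<Rightarrow> 'a set \<Rightarrow> bool" where
  "is_component V E C \<longleftrightarrow> C \<subseteq> V \<and> connected_on E C \<and>
     (\<forall>C'. C \<subset> C' \<and> C' \<subseteq> V \<longrightarrow> \<not> connected_on E C')"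

definition is_triangle :: "'a set \<Rightarrow> 'a set set \<Rightarrow> 'a set \<Rightarrow> bool" where
  "is_triangle V E T \<longleftrightarrow> T \<subseteq> V \<and> card T = 3 \<and> (\<forall>u\<in>T. \<forall>v\<in>T. u \<noteq> v \<longrightarrow> {u, v} \<in> E)"

definition tri_edges :: "'a set \<Rightarrow> 'a set set" where
  "tri_edges T = {e. e \<subseteq> T \<and> card e = 2}"

definition triangle_tree :: "'a set \<Rightarrow> 'a set set \<Rightarrow> bool" where
  "triangle_tree V E \<longleftrightarrow> connected_on E V \<and> (\<forall>B. is_block V E B \<longrightarrow> is_triangle V E B)"

definition triangle_forest :: "'a set \<Rightarrow> 'a set set \<Rightarrow> bool" where
  "triangle_forest V E \<longleftrightarrow>
     (\<forall>C. is_component V E C \<longrightarrow> triangle_tree C {e \<in> E. e \<subseteq> C})"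

definition degree :: "'a set set \<Rightarrow> 'a \<Rightarrow> nat" where
  "degree E v = card {e \<in> E. v \<in> e}"

definition line_graph_edges :: "'a set set \<Rightarrow> 'a set set set" where
  "line_graph_edges E = {{e, f} | e f. e \<in> E \<and> f \<in> E \<and> e \<noteq> f \<and> e \<inter> f \<noteq> {}}"

definition path_edges :: "'v list \<Rightarrow> 'v set list" where
  "path_edges ps = map (\<lambda>(a, b). {a, b}) (zip ps (tl ps))"

definition is_path :: "'v set set \<Rightarrow> 'v list \<Rightarrow> 'v \<Rightarrow> 'v \<Rightarrow> bool" where
  "is_path E ps u v \<longleftrightarrow> ps \<noteq> [] \<and> hd ps = u \<and> last ps = v \<and> distinct ps \<and>
     set (path_edges ps) \<subseteq> E"

definition rainbow_connected :: "'v set \<Rightarrow> 'v set set \<Rightarrow> ('v set \<Rightarrow> nat) \<Rightarrow> bool" where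
  "rainbow_connected V E c \<longleftrightarrow>
     (\<forall>u\<in>V. \<forall>v\<in>V. \<exists>ps. is_path E ps u v \<and> distinct (map c (path_edges ps)))"

definition rc :: "'v set \<Rightarrow> 'v set set \<Rightarrow> nat" where
  "rc V E = (LEAST k. \<exists>c. (\<forall>e\<in>E. c e < k) \<and> rainbow_connected V E c)"

definition rc_line :: "'a set \<Rightarrow> 'a set set \<Rightarrow> nat" where
  "rc_line V E = rc E (line_graph_edges E)"

definition n2 :: "'a set \<Rightarrow> 'a set set \<Rightarrow> nat" where
  "n2 V E = card {v \<in> V. degree E v \<ge> 2}"

definition good_triangle_set :: "'a set \<Rightarrow> 'a set set \<Rightarrow> 'a set set \<Rightarrow> bool" where
  "good_triangle_set V E \<T> \<longleftrightarrow>
     (\<forall>T\<in>\<T>. is_triangle V E T) \<and>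
     (\<forall>T1\<in>\<T>. \<forall>T2\<in>\<T>. T1 \<noteq> T2 \<longrightarrow> tri_edges T1 \<inter> tri_edges T2 = {}) \<and>
     triangle_forest (\<Union>(\<Union>(tri_edges ` \<T>))) (\<Union>(tri_edges ` \<T>))"

end

theory Submission
  imports Defs
begin

text \<open>Colouring each edge of the line graph by the vertex shared by its two ends needs one colour per
  vertex of degree at least 2. To save one colour per triangle, grow a spanning tree that contains,
  for each chosen triangle with vertices \<open>p\<close>, \<open>b\<close>, \<open>c\<close>, the edges \<open>pb\<close> and \<open>pc\<close> with \<open>p\<close> as parent; the
  forest condition makes this possible. Now \<open>b\<close> and \<open>c\<close> share a colour, except that at \<open>c\<close> the
  transitions to or from \<open>bc\<close> (other than to \<open>pc\<close>) use the colour of \<open>p\<close>: a tree path crossing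
  \<open>bc\<close> turns downwards there and never meets \<open>p\<close> or a vertex above it. For sharpness, join \<open>t\<close> disjoint triangles
  in a chain by bridges and append a pendant edge at each end: the line graph has diameter \<open>2t\<close>.\<close>

section \<open>Rainbow colourings from spanning trees with adjacent siblings\<close>

lemma finite_edges: "graph V E \<Longrightarrow> finite E"
  by (auto simp: graph_def intro: finite_subset[of _ "Pow V"])

lemma degree_ge_2:
  assumes "finite E" "h \<in> E" "h' \<in> E" "h \<noteq> h'" "v \<in> h" "v \<in> h'"
  shows "degree E v \<ge> 2"
proof -
  have "card {h, h'} \<le> degree E v"
    unfolding degree_def using assms by (intro card_mono) auto
  with assms show ?thesis by simp
qed

text \<open>The edges \<open>e\<close>, \<open>{g 0, g 1}\<close>, ...,
  \<open>{g (n - 1), g n}\<close>, \<open>f\<close> of a trail, indexed so that edges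
  \<open>k\<close> and \<open>k + 1\<close> meet in \<open>g k\<close> and the transitions are
  numbered from \<open>0\<close> to \<open>n\<close>.\<close>

definition trail_edge :: "'v set \<Rightarrow> 'v set \<Rightarrow> nat \<Rightarrow> (nat \<Rightarrow> 'v) \<Rightarrow> nat \<Rightarrow> 'v set" where
  "trail_edge e f n g k = (if k = 0 then e else if k = Suc n then f else {g (k - 1), g k})"

text \<open>\<open>C\<close> picks one child \<open>c\<close> of each triangle, \<open>bb c\<close> is the other child.\<close>

locale sibling_tree =
  fixes V :: "'a set" and E :: "'a set set" and r :: 'a and par :: "'a \<Rightarrow> 'a"
    and dep :: "'a \<Rightarrow> nat" and C :: "'a set" and bb :: "'a \<Rightarrow> 'a"
  assumes root: "v \<in> V \<Longrightarrow> dep v = 0 \<Longrightarrow> v = r"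
    and parent: "v \<in> V \<Longrightarrow> dep v > 0 \<Longrightarrow> par v \<in> V \<and> {v, par v} \<in> E \<and> dep v = Suc (dep (par v))"
    and sibling: "c \<in> C \<Longrightarrow> c \<in> V \<and> bb c \<in> V \<and> bb c \<notin> C \<and> dep c > 0 \<and> dep (bb c) > 0 \<and>
      par (bb c) = par c \<and> {c, bb c} \<in> E"
    and inj_bb: "inj_on bb C"
begin

definition anc :: "nat \<Rightarrow> 'a \<Rightarrow> 'a" where "anc k u = (par ^^ k) u"

definition sib :: "'a \<Rightarrow> 'a \<Rightarrow> bool" where
  "sib x y \<longleftrightarrow> x \<in> C \<and> y = bb x \<or> y \<in> C \<and> x = bb y"

text \<open>Representatives of the colour classes: both lower vertices of a triangle are sent to the
  one outside \<open>C\<close>, so vertices of \<open>C\<close> need no colour of their own.\<close>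

definition rep :: "'a \<Rightarrow> 'a" where "rep v = (if v \<in> C then bb v else v)"

text \<open>The colour of the transition \<open>X = {e, f}\<close> at \<open>v\<close> is that of \<open>shift v X\<close>.\<close>

definition shift :: "'a \<Rightarrow> 'a set set \<Rightarrow> 'a" where
  "shift v X = (if v \<in> C \<and> {v, bb v} \<in> X \<and> {v, par v} \<notin> X then par v else v)"

section \<open>Ancestors, siblings and colour classes in the tree\<close>

lemma anc_0 [simp]: "anc 0 u = u"
  by (simp add: anc_def)

lemma anc_Suc: "anc (Suc k) u = par (anc k u)"
  by (simp add: anc_def)

lemma anc_add: "anc (k + l) u = anc k (anc l u)"
  by (simp add: anc_def funpow_add)

lemma anc_in: "u \<in> V \<Longrightarrow> k \<le> dep u \<Longrightarrow> anc k u \<in> V \<and> dep (anc k u) = dep u - k"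
proof (induction k)
  case (Suc k)
  then have "anc k u \<in> V" "dep (anc k u) = dep u - k" by auto
  with parent[of "anc k u"] Suc.prems have "dep u - k = Suc (dep (anc (Suc k) u))" "anc (Suc k) u \<in> V"
    by (auto simp: anc_Suc)
  then show ?case by simp
qed simp

lemma dep_bb: "c \<in> C \<Longrightarrow> dep (bb c) = dep c"
  using sibling[of c] parent[of c] parent[of "bb c"] by simp

text \<open>Colour classes stay within one level of the tree, so depth can tell colours
  apart.\<close>

lemma dep_rep: "dep (rep x) = dep x"
  by (simp add: rep_def dep_bb)

lemma sib_dep: "sib x y \<Longrightarrow> dep x = dep y"
  by (auto simp: sib_def dep_bb)

lemma rep_eqD: "rep x = rep y \<Longrightarrow> x = y \<or> sib x y"
  using inj_bb by (auto simp: rep_def sib_def inj_on_def split: if_splits)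

lemma sib_edge: "sib x y \<Longrightarrow> {x, y} \<in> E"
  using sibling by (auto simp: sib_def insert_commute)

lemma sib_par: "sib x y \<Longrightarrow> par x = par y \<and> dep x > 0 \<and> dep y > 0"
  using sibling by (auto simp: sib_def)

text \<open>A sibling step is weighted by 3 and a tree step by 2: the detour over the common parent
  is then more expensive, but ending at the parent is cheaper than ending at a sibling.\<close>

lemma ex_rainbow_trail:
  assumes gr: "graph V E" and e: "e \<in> E" and f: "f \<in> E" and ef: "e \<noteq> f"
  shows "\<exists>n g. inj_on g {..n} \<and> (\<forall>k<n. {g k, g (Suc k)} \<in> E) \<and>
    e \<inter> g ` {..n} = {g 0} \<and> f \<inter> g ` {..n} = {g n} \<and>
    inj_on (\<lambda>k. rep (shift (g k) {trail_edge e f n g k, trail_edge e f n g (Suc k)})) {..n}"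
proof -
  have EV: "x \<in> V" if "x \<in> h" "h \<in> E" for x h using that gr by (auto simp: graph_def)
  obtain u0 where u0: "u0 \<in> e" using gr e by (fastforce simp: graph_def)
  obtain v0 where v0: "v0 \<in> f" using gr f by (fastforce simp: graph_def)
  \<comment> \<open>A tuple describes a trail: climb \<open>i\<close> levels from \<open>u\<close>
    on \<open>e\<close>, cross a sibling edge if \<open>s = 1\<close>, and descend \<open>j\<close>
    levels to \<open>v\<close> on \<open>f\<close>. Its cost is \<open>m\<close>.\<close>
  define P where "P = (\<lambda>(u, v, i, j, s :: nat). u \<in> e \<and> v \<in> f \<and> i \<le> dep u \<and> j \<le> dep v \<and>
    (s = 0 \<and> anc i u = anc j v \<or> s = 1 \<and> sib (anc i u) (anc j v)))"
  define m where "m = (\<lambda>(u :: 'a, v :: 'a, i, j, s). 2 * (i + j) + 3 * s :: nat)"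
  \<comment> \<open>Climbing from both edges up to the root gives one admissible tuple, so a
    cheapest one exists.\<close>
  have "anc (dep u0) u0 = anc (dep v0) v0"
    using anc_in[of u0 "dep u0"] anc_in[of v0 "dep v0"] root EV u0 v0 e f by (metis diff_self_eq_0 order_refl)
  then have "P (u0, v0, dep u0, dep v0, 0)" using u0 v0 by (simp add: P_def)
  then obtain q where q: "P q" "\<And>y. P y \<Longrightarrow> m q \<le> m y" using ex_has_least_nat[of P _ m] by blast
  obtain u v i j s where qq: "q = (u, v, i, j, s)" by (cases q) auto
  have u: "u \<in> e" and v: "v \<in> f" and i: "i \<le> dep u" and j: "j \<le> dep v"
    and s: "s = 0 \<and> anc i u = anc j v \<or> s = 1 \<and> sib (anc i u) (anc j v)"
    using q(1) by (auto simp: P_def qq)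
  have M0: "2 * (i + j) + 3 * s \<le> 2 * (a + b)"
    if "u' \<in> e" "v' \<in> f" "a \<le> dep u'" "b \<le> dep v'" "anc a u' = anc b v'" for u' v' a b
    using q(2)[of "(u', v', a, b, 0)"] that by (simp add: P_def m_def qq)
  have M1: "2 * (i + j) + 3 * s \<le> 2 * (a + b) + 3"
    if "u' \<in> e" "v' \<in> f" "a \<le> dep u'" "b \<le> dep v'" "sib (anc a u') (anc b v')" for u' v' a b
    using q(2)[of "(u', v', a, b, 1)"] that by (simp add: P_def m_def qq)
  have uV: "u \<in> V" and vV: "v \<in> V" using EV u v e f by auto
  define n where "n = i + j + s"
  \<comment> \<open>For \<open>s = 0\<close> both branches agree at the common ancestor
    \<open>g i\<close>; for \<open>s = 1\<close> the step from \<open>i\<close> to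
    \<open>Suc i\<close> is the sibling edge.\<close>
  define g where "g k = (if k \<le> i then anc k u else anc (n - k) v)" for k
  define top where "top = dep (anc i u)"
  have top2: "top = dep (anc j v)" using s sib_dep by (auto simp: top_def)
  have top_u: "dep u = top + i" using anc_in[OF uV i] i by (simp add: top_def)
  have top_v: "dep v = top + j" using anc_in[OF vV j] j by (simp add: top2)
  have s1: "s \<le> 1" using s by auto
  have gu: "g k = anc k u" if "k \<le> i" for k using that by (simp add: g_def)
  have gv: "g k = anc (n - k) v" if "i + s \<le> k" for k
    using that s by (cases "k = i") (auto simp: g_def n_def)
  have dgu: "dep (g k) = top + (i - k)" "g k \<in> V" if "k \<le> i" for k
    using that anc_in[OF uV, of k] top_u by (auto simp: gu)
  have dgv: "dep (g k) = top + (k - i - s)" "g k \<in> V" if "i + s \<le> k" "k \<le> n" for k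
    using that anc_in[OF vV, of "n - k"] top_v by (auto simp: gv n_def)
  have split: "k \<le> i \<or> i + s \<le> k \<and> i < k" for k using s1 by auto
  have dtop: "top \<le> dep (g k)" "g k \<in> V" if "k \<le> n" for k
    using split[of k] dgu[of k] dgv[of k] that by auto
  \<comment> \<open>On one side of the top, depths tell positions apart; a vertex common to both
    sides would be a cheaper meeting point.\<close>
  have inj: "g k \<noteq> g l" if "k < l" "l \<le> n" for k l
  proof
    assume eq: "g k = g l"
    show False
    proof (cases "l \<le> i \<or> i < k")
      case True
      then show False using dgu(1)[of k] dgu(1)[of l] dgv(1)[of k] dgv(1)[of l] eq that s1 by auto
    next
      case False
      then have kl: "k \<le> i" "i + s \<le> l" "i < l" using s1 by auto
      then have "anc k u = anc (n - l) v" using eq gu gv by metis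
      moreover have "k \<le> dep u" "n - l \<le> dep v" using kl i j by (auto simp: n_def)
      ultimately have "2 * (i + j) + 3 * s \<le> 2 * (k + (n - l))" using M0[OF u v] by blast
      with kl that s1 show False by (auto simp: n_def)
    qed
  qed
  \<comment> \<open>Equal depths put \<open>k\<close> and \<open>l\<close> on opposite sides.
    Minimality then gives \<open>2 * (l - k) + s \<le> 3\<close>, hence \<open>l = k + 1\<close>:
    here a sibling step has to cost less than two tree steps over the common parent.\<close>
  have sibs: "s = 1 \<and> k = i \<and> l = Suc i" if "k < l" "l \<le> n" and sb: "sib (g k) (g l)" for k l
  proof -
    have d: "dep (g k) = dep (g l)" using sb sib_dep by blast
    have kl: "k \<le> i" "i < l"
      using dgu(1)[of k] dgu(1)[of l] dgv(1)[of k] dgv(1)[of l] d that s1 by (force simp: not_le)+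
    then have l: "i + s \<le> l" using s1 by auto
    then have "sib (anc k u) (anc (n - l) v)" using sb gu gv kl by metis
    moreover have "k \<le> dep u" "n - l \<le> dep v" using kl l i j by (auto simp: n_def)
    ultimately have "2 * (i + j) + 3 * s \<le> 2 * (k + (n - l)) + 3" using M1[OF u v] by blast
    with kl l that s1 d dgu(1)[OF kl(1)] dgv(1)[OF l] show ?thesis by (auto simp: n_def)
  qed
  have g0: "g 0 = u" by (simp add: g_def)
  have gn: "g n = v" using gv[of n] by (simp add: n_def)
  have step_u: "g (Suc k) = par (g k)" if "k < i" for k using that by (simp add: gu anc_Suc)
  have step_v: "g k = par (g (Suc k))" if "i + s \<le> k" "k < n" for k
    using that gv[of k] gv[of "Suc k"] anc_Suc[of "n - Suc k" v] by (simp add: Suc_diff_Suc)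
  have mid: "sib (g i) (g (Suc i))" "Suc i \<le> n" if "s = 1"
    using that s gu[of i] gv[of "Suc i"] by (auto simp: n_def)
  have edge: "{g k, g (Suc k)} \<in> E" if "k < n" for k
  proof -
    consider "k < i" | "i + s \<le> k" | "k = i" "s = 1" using s1 by linarith
    then show ?thesis
    proof cases
      case 1
      then show ?thesis using parent[of "g k"] dgu[of k] step_u by auto
    next
      case 2
      then show ?thesis using parent[of "g (Suc k)"] dgv[of "Suc k"] step_v[of k] that
        by (auto simp: insert_commute)
    next
      case 3
      then show ?thesis using mid sib_edge by auto
    qed
  qed
  \<comment> \<open>A later trail vertex on \<open>e\<close> would be a cheaper starting
    point.\<close>
  have e_only: "k = 0" if "g k \<in> e" "k \<le> n" for k
  proof (rule ccontr)
    assume k0: "k \<noteq> 0"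
    show False
    proof (cases "k \<le> i")
      case True
      then have a: "anc (i - k) (g k) = anc i u" using anc_add[of "i - k" k u] gu by simp
      have "i - k \<le> dep (g k)" using dgu[OF True] by simp
      then show False using M0[OF that(1) v _ j, of "i - k"] M1[OF that(1) v _ j, of "i - k"] s a k0 True
        by auto
    next
      case False
      then have "i + s \<le> k" using s1 by auto
      then have "anc 0 (g k) = anc (n - k) v" using gv by simp
      moreover have "n - k \<le> dep v" using False s1 top_v that by (auto simp: n_def)
      ultimately have "2 * (i + j) + 3 * s \<le> 2 * (0 + (n - k))" using M0[OF that(1) v] by blast
      then show False using False s1 that by (auto simp: n_def)
    qed
  qed
  have f_only: "k = n" if "g k \<in> f" "k \<le> n" for k
  proof (rule ccontr)
    assume k0: "k \<noteq> n"
    show False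
    proof (cases "k \<le> i")
      case True
      then have "anc k u = anc 0 (g k)" using gu by simp
      from M0[OF u that(1) _ _ this] True i k0 that show False by (auto simp: n_def)
    next
      case False
      then have ik: "i + s \<le> k" using s1 by auto
      define b where "b = j - (n - k)"
      have b: "b + (n - k) = j" using ik that by (auto simp: b_def n_def)
      have a: "anc b (g k) = anc j v" using anc_add[of b "n - k" v] gv[OF ik] b by simp
      have "b \<le> dep (g k)" using dgv[OF ik that(2)] ik that by (auto simp: b_def n_def)
      then show False using M0[OF u that(1) i, of b] M1[OF u that(1) i, of b] s a k0 b that
        by auto
    qed
  qed
  let ?ed = "trail_edge e f n g"
  define X where "X k = {?ed k, ?ed (Suc k)}" for k
  \<comment> \<open>The transitions at which \<open>shift\<close> moves the colour up to the
    parent.\<close>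
  define exc where "exc k \<longleftrightarrow> g k \<in> C \<and> {g k, bb (g k)} \<in> X k \<and> {g k, par (g k)} \<notin> X k" for k
  \<comment> \<open>Away from the top, one of the two trail edges at \<open>g k\<close> is its tree
    edge to the parent, which rules out a shift.\<close>
  have exc_top: "i \<le> k \<and> k \<le> i + s" if "exc k" "k \<le> n" for k
  proof (rule ccontr)
    assume "\<not> ?thesis"
    then consider "k < i" | "i + s < k" by linarith
    then have "{g k, par (g k)} \<in> X k"
    proof cases
      case 1
      then have "?ed (Suc k) = {g k, par (g k)}" using step_u by (simp add: trail_edge_def n_def)
      then show ?thesis by (simp add: X_def)
    next
      case 2
      then have "?ed k = {g k, par (g k)}" using step_v[of "k - 1"] that(2)
        by (auto simp: trail_edge_def insert_commute)
      then show ?thesis by (simp add: X_def)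
    qed
    with that show False by (simp add: exc_def)
  qed
  \<comment> \<open>A shifted colour belongs to a level above the whole trail, so it differs from
    every unshifted one.\<close>
  have exc_dep: "dep (rep (shift (g k) (X k))) < top" if "exc k" "k \<le> n" for k
  proof -
    have "k = i \<or> k = i + s" using exc_top[OF that] s1 by linarith
    then have "dep (g k) = top" using dgu(1)[of k] dgv(1)[of k] that(2) by auto
    moreover have "g k \<in> C" using that by (simp add: exc_def)
    ultimately show ?thesis using that parent[of "g k"] sibling[of "g k"]
      by (simp add: dep_rep shift_def exc_def)
  qed
  have noexc: "shift (g k) (X k) = g k" if "\<not> exc k" for k
    using that by (auto simp: shift_def exc_def)
  \<comment> \<open>When a sibling edge is crossed, its end in \<open>C\<close> gets a shifted
    colour; the point is that the parent edge is not part of the transition there.\<close>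
  have mid_exc: "exc i \<or> exc (Suc i)" if s_1: "s = 1"
  proof -
    note sb = mid(1)[OF s_1] and le = mid(2)[OF s_1]
    have n1: "n = Suc (i + j)" using s_1 by (simp add: n_def)
    have edS: "?ed (Suc i) = {g i, g (Suc i)}" using n1 by (simp add: trail_edge_def)
    have d: "dep (g i) = top" "dep (g (Suc i)) = top" using dgu(1)[of i] dgv(1)[of "Suc i"] s_1 le by auto
    have pp: "par (g i) = par (g (Suc i))" "top > 0" using sib_par[OF sb] d by auto
    have dp: "dep (par (g i)) < top" using parent[of "g i"] dgu[of i] d pp by auto
    from sb consider "g i \<in> C" "g (Suc i) = bb (g i)" | "g (Suc i) \<in> C" "g i = bb (g (Suc i))"
      by (auto simp: sib_def)
    then show ?thesis
    proof cases
      case 1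
      have "{g i, par (g i)} \<noteq> ?ed (Suc i)"
        using dp d unfolding edS by (metis doubleton_eq_iff less_irrefl)
      moreover have "{g i, par (g i)} \<noteq> ?ed i"
      proof
        assume a: "{g i, par (g i)} = ?ed i"
        show False
        proof (cases "i = 0")
          case True
          then have "par (g i) \<in> e" using a by (auto simp: trail_edge_def)
          moreover have "anc 0 (par (g i)) = anc (Suc j) v" using pp gv[of "Suc i"] s_1 n1
            by (simp add: anc_Suc)
          \<comment> \<open>If \<open>e\<close> contained the common parent, starting there would
            cost \<open>2 * (j + 1)\<close>, less than the present \<open>2 * j + 3\<close>.\<close>
          ultimately show False using M0[of "par (g i)" v 0 "Suc j"] v top_v pp True s_1 by simp
        next
          case False
          then have "?ed i = {g (i - 1), g i}" using n1 by (simp add: trail_edge_def)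
          with a have "par (g i) \<in> {g (i - 1), g i}" by auto
          then show False using dp d dgu(1)[of "i - 1"] by auto
        qed
      qed
      ultimately have "exc i" using 1 by (auto simp: exc_def X_def edS)
      then show ?thesis ..
    next
      case 2
      have "{g (Suc i), par (g (Suc i))} \<noteq> ?ed (Suc i)"
        using dp d pp unfolding edS by (metis doubleton_eq_iff less_irrefl)
      moreover have "{g (Suc i), par (g (Suc i))} \<noteq> ?ed (Suc (Suc i))"
      proof
        assume a: "{g (Suc i), par (g (Suc i))} = ?ed (Suc (Suc i))"
        show False
        proof (cases "j = 0")
          case True
          then have "par (g i) \<in> f" using a pp n1 by (auto simp: trail_edge_def)
          moreover have "anc (Suc i) u = anc 0 (par (g i))" using gu[of i] by (simp add: anc_Suc)
          ultimately show False using M0[of u "par (g i)" "Suc i" 0] u top_u pp True s_1 by simp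
        next
          case False
          then have "?ed (Suc (Suc i)) = {g (Suc i), g (Suc (Suc i))}" using n1 by (simp add: trail_edge_def)
          with a pp have "par (g i) \<in> {g (Suc i), g (Suc (Suc i))}" by auto
          then show False using dp d dgv(1)[of "Suc (Suc i)"] s_1 n1 False by auto
        qed
      qed
      ultimately have "exc (Suc i)" using 2 by (auto simp: exc_def X_def edS insert_commute)
      then show ?thesis ..
    qed
  qed
  \<comment> \<open>Two shifted transitions would need both siblings in \<open>C\<close>; a shifted
    and an unshifted one differ in depth; two unshifted ones of equal colour would sit at the
    crossed siblings, one of which is shifted.\<close>
  have rainbow: "rep (shift (g k) (X k)) \<noteq> rep (shift (g l) (X l))" if kl: "k < l" "l \<le> n" for k l
  proof
    assume eq: "rep (shift (g k) (X k)) = rep (shift (g l) (X l))"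
    consider "exc k" "exc l" | "exc k" "\<not> exc l" | "\<not> exc k" "exc l" | "\<not> exc k" "\<not> exc l" by blast
    then show False
    proof cases
      case 1
      then have "k = i" "l = Suc i" "s = 1" using exc_top[of k] exc_top[of l] kl s1 by auto
      then have "sib (g k) (g l)" using mid by simp
      with 1 sibling show False by (auto simp: sib_def exc_def)
    next
      case 2
      then show False using exc_dep[of k] noexc[of l] dtop[of l] kl eq by (simp add: dep_rep)
    next
      case 3
      then show False using exc_dep[of l] noexc[of k] dtop[of k] kl eq[symmetric] by (simp add: dep_rep)
    next
      case 4
      then have "rep (g k) = rep (g l)" using eq noexc by simp
      then have "sib (g k) (g l)" using rep_eqD inj[OF kl] by blast
      then have "s = 1 \<and> k = i \<and> l = Suc i" using sibs kl by blast
      then show False using mid_exc 4 by blast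
    qed
  qed
  have "inj_on g {..n}" using inj by (intro linorder_inj_onI) auto
  moreover have "e \<inter> g ` {..n} = {g 0}" using e_only u g0 by force
  moreover have "f \<inter> g ` {..n} = {g n}" using f_only v gn by force
  moreover have "inj_on (\<lambda>k. rep (shift (g k) (X k))) {..n}"
    using rainbow by (intro linorder_inj_onI) auto
  ultimately show ?thesis using edge unfolding X_def by blast
qed

section \<open>From rainbow trails to a colouring of the line graph\<close>

lemma rep_in: "v \<in> V \<Longrightarrow> rep v \<in> V - C"
  using sibling by (auto simp: rep_def)

text \<open>\<open>x\<close>, \<open>bb x\<close> and \<open>par x\<close> form a triangle. This
  keeps the vertices chosen by \<open>rep\<close> and \<open>shift\<close> among those of degree at
  least 2.\<close>

lemma sib_deg:
  assumes gr: "graph V E" and x: "x \<in> C"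
  shows "degree E x \<ge> 2" "degree E (bb x) \<ge> 2" "degree E (par x) \<ge> 2"
proof -
  note fin = finite_edges[OF gr] and s = sibling[OF x] and p = parent[of x] and q = parent[of "bb x"]
  have "par x \<noteq> x" using p s by force
  moreover have "par x \<noteq> bb x" using s q by force
  moreover have "x \<noteq> bb x" using s x by metis
  ultimately have "{x, bb x} \<noteq> {bb x, par x}" "{x, par x} \<noteq> {bb x, par x}" "{x, par x} \<noteq> {x, bb x}"
    by (auto simp: doubleton_eq_iff)
  then show "degree E x \<ge> 2" "degree E (bb x) \<ge> 2" "degree E (par x) \<ge> 2"
    using s p q degree_ge_2[OF fin, of "{x, bb x}" "{bb x, par x}" "bb x"]
      degree_ge_2[OF fin, of "{x, par x}" "{bb x, par x}" "par x"]
      degree_ge_2[OF fin, of "{x, par x}" "{x, bb x}" "x"]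
    by auto
qed

text \<open>The edges of a rainbow trail are the vertices of a path in the line graph, and its
  transitions are the edges of that path.\<close>

lemma rainbow_colouring:
  assumes gr: "graph V E"
  shows "\<exists>c. (\<forall>X\<in>line_graph_edges E. c X < card ({v \<in> V. degree E v \<ge> 2} - C)) \<and>
    rainbow_connected E (line_graph_edges E) c"
proof -
  have finV: "finite V" using gr by (simp add: graph_def)
  note finE = finite_edges[OF gr]
  have card2: "card h = 2" "h \<subseteq> V" if "h \<in> E" for h using gr that by (auto simp: graph_def)
  define K where "K = {v \<in> V. degree E v \<ge> 2} - C"
  have "finite K" using finV by (simp add: K_def)
  then obtain idx where idx: "bij_betw idx K {..<card K}"
    using ex_bij_betw_finite_nat[of K] by (auto simp: atLeast0LessThan)
  \<comment> \<open>Two distinct edges that meet share exactly one vertex, recovered here as the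
    element of \<open>\<Inter>X\<close>.\<close>
  define col where "col X = idx (rep (shift (the_elem (\<Inter>X)) X))" for X
  have Int: "the_elem (\<Inter>{h, h'}) = x" if "h \<in> E" "h' \<in> E" "h \<noteq> h'" "x \<in> h" "x \<in> h'" for h h' x
  proof -
    from card2(1)[OF that(1)] card2(1)[OF that(2)] that obtain a b where "h = {x, a}" "h' = {x, b}"
      by (metis card_2_iff doubleton_eq_iff empty_iff insert_iff)
    with that have "h \<inter> h' = {x}" by auto
    then show ?thesis by simp
  qed
  have repK: "rep (shift x {h, h'}) \<in> K" if "h \<in> E" "h' \<in> E" "h \<noteq> h'" "x \<in> h" "x \<in> h'" for h h' x
  proof -
    have "x \<in> V" "degree E x \<ge> 2" using that card2 degree_ge_2[OF finE] by blast+
    then have "shift x {h, h'} \<in> V" "degree E (shift x {h, h'}) \<ge> 2"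
      using sib_deg[OF gr] parent[of x] sibling[of x] by (auto simp: shift_def)
    then show ?thesis using rep_in sib_deg[OF gr] by (auto simp: K_def rep_def)
  qed
  have "col X < card K" if "X \<in> line_graph_edges E" for X
  proof -
    from that obtain h h' x where h: "X = {h, h'}" "h \<in> E" "h' \<in> E" "h \<noteq> h'" "x \<in> h" "x \<in> h'"
      by (auto simp: line_graph_edges_def)
    then have "col X = idx (rep (shift x X))" using Int by (simp add: col_def)
    then show ?thesis using repK[OF h(2-)] h(1) idx by (auto simp: bij_betw_def)
  qed
  moreover have "\<exists>ps. is_path (line_graph_edges E) ps e f \<and> distinct (map col (path_edges ps))"
    if e: "e \<in> E" and f: "f \<in> E" for e f
  proof (cases "e = f")
    case True
    then have "is_path (line_graph_edges E) [e] e f" "distinct (map col (path_edges [e]))"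
      by (auto simp: is_path_def path_edges_def)
    then show ?thesis by blast
  next
    case False
    obtain n g where g: "inj_on g {..n}" "\<And>k. k < n \<Longrightarrow> {g k, g (Suc k)} \<in> E"
      "e \<inter> g ` {..n} = {g 0}" "f \<inter> g ` {..n} = {g n}"
      "inj_on (\<lambda>k. rep (shift (g k) {trail_edge e f n g k, trail_edge e f n g (Suc k)})) {..n}"
      using ex_rainbow_trail[OF gr e f False] by blast
    define h where "h = trail_edge e f n g"
    have hk: "h 0 = e" "h (Suc n) = f" "\<And>k. 0 < k \<Longrightarrow> k \<le> n \<Longrightarrow> h k = {g (k - 1), g k}"
      by (auto simp: h_def trail_edge_def)
    have hE: "h k \<in> E" if "k \<le> Suc n" for k
      using that e f g(2)[of "k - 1"] by (auto simp: h_def trail_edge_def)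
    have mem: "g k \<in> h k" "g k \<in> h (Suc k)" if "k \<le> n" for k
      using that g(3,4) by (auto simp: h_def trail_edge_def)
    have geq: "g k = g l \<longleftrightarrow> k = l" if "k \<le> n" "l \<le> n" for k l
      using g(1) that by (auto simp: inj_on_def)
    \<comment> \<open>A repeated edge would mean \<open>e = f\<close>, or put two trail vertices on
      \<open>e\<close> or on \<open>f\<close>, or make \<open>g\<close> repeat a vertex.\<close>
    have ne: "h k \<noteq> h l" if kl: "k < l" "l \<le> Suc n" for k l
    proof
      assume eq: "h k = h l"
      consider "k = 0" "l = Suc n" | "k = 0" "l \<le> n" | "k > 0" "l = Suc n" | "k > 0" "l \<le> n"
        using kl by linarith
      then show False
      proof cases
        case 1
        with eq False hk show False by simp
      next
        case 2
        then have "g (l - 1) \<in> e \<inter> g ` {..n}" "g l \<in> e \<inter> g ` {..n}" using eq hk kl by auto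
        then have "g (l - 1) = g 0" "g l = g 0" unfolding g(3) by auto
        then show False using 2 kl geq by simp
      next
        case 3
        then have "g (k - 1) \<in> f \<inter> g ` {..n}" "g k \<in> f \<inter> g ` {..n}" using eq[symmetric] hk kl by auto
        then have "g (k - 1) = g n" "g k = g n" unfolding g(4) by auto
        then show False using 3 kl geq[of "k - 1" n] geq[of k n] by auto
      next
        case 4
        then have "{g (k - 1), g k} = {g (l - 1), g l}" using eq hk kl by simp
        then show False using 4 kl geq by (auto simp: doubleton_eq_iff)
      qed
    qed
    define ps where "ps = map h [0..<Suc (Suc n)]"
    have pe: "path_edges ps = map (\<lambda>k. {h k, h (Suc k)}) [0..<Suc n]"
      unfolding ps_def path_edges_def by (rule nth_equalityI) (auto simp: nth_tl simp del: upt_Suc)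
    have colh: "col {h k, h (Suc k)} = idx (rep (shift (g k) {h k, h (Suc k)}))" if "k \<le> n" for k
      using that Int[of "h k" "h (Suc k)" "g k"] hE mem ne[of k "Suc k"] by (simp add: col_def)
    have "inj_on h {..<Suc (Suc n)}" using ne by (intro linorder_inj_onI) auto
    then have "distinct ps" unfolding ps_def by (simp add: distinct_map atLeast0LessThan del: upt_Suc)
    moreover have "hd ps = e" "last ps = f" "ps \<noteq> []"
      by (auto simp: ps_def hd_map last_map hk simp del: upt_Suc)
    moreover have "set (path_edges ps) \<subseteq> line_graph_edges E"
    proof -
      have "{h k, h (Suc k)} \<in> line_graph_edges E" if "k \<le> n" for k
      proof -
        have "h k \<in> E \<and> h (Suc k) \<in> E \<and> h k \<noteq> h (Suc k) \<and> h k \<inter> h (Suc k) \<noteq> {}"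
          using that hE[of k] hE[of "Suc k"] ne[of k "Suc k"] mem[of k] by auto
        then show ?thesis unfolding line_graph_edges_def mem_Collect_eq
          by (intro exI[of _ "h k"] exI[of _ "h (Suc k)"] conjI) auto
      qed
      then show ?thesis by (auto simp: pe simp del: upt_Suc)
    qed
    moreover have "inj_on (\<lambda>k. col {h k, h (Suc k)}) {..<Suc n}"
    proof (rule inj_onI)
      fix k l assume "k \<in> {..<Suc n}" "l \<in> {..<Suc n}" and eq: "col {h k, h (Suc k)} = col {h l, h (Suc l)}"
      then have k: "k \<le> n" and l: "l \<le> n" by auto
      have inK: "rep (shift (g m) {h m, h (Suc m)}) \<in> K" if "m \<le> n" for m
        using that hE[of m] hE[of "Suc m"] ne[of m "Suc m"] mem[of m] by (intro repK) auto
      have "inj_on idx K" using idx by (simp add: bij_betw_def)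
      from inj_onD[OF this eq[unfolded colh[OF k] colh[OF l]] inK[OF k] inK[OF l]]
      show "k = l" using inj_onD[OF g(5)] k l by (simp add: h_def)
    qed
    then have "distinct (map col (path_edges ps))"
      by (simp add: pe distinct_map comp_def inj_on_def lessThan_atLeast0 del: upt_Suc)
    ultimately show ?thesis unfolding is_path_def by blast
  qed
  ultimately show ?thesis unfolding rainbow_connected_def K_def by blast
qed

end

section \<open>Growing the spanning tree\<close>

lemma adj_rtrancl_sym: "(x, y) \<in> (adj_in E S)\<^sup>* \<Longrightarrow> (y, x) \<in> (adj_in E S)\<^sup>*"
proof -
  have "sym (adj_in E S)" by (auto simp: sym_def adj_in_def insert_commute)
  then show "(x, y) \<in> (adj_in E S)\<^sup>* \<Longrightarrow> (y, x) \<in> (adj_in E S)\<^sup>*"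
    using sym_rtrancl by (metis symD)
qed

lemma adj_rtrancl_mono: "(x, y) \<in> (adj_in E S)\<^sup>* \<Longrightarrow> S \<subseteq> S' \<Longrightarrow> (x, y) \<in> (adj_in E S')\<^sup>*"
  by (rule subsetD[OF rtrancl_mono]) (auto simp: adj_in_def)

lemma connected_onI:
  assumes "x \<in> S" "\<And>y. y \<in> S \<Longrightarrow> (x, y) \<in> (adj_in E S)\<^sup>*"
  shows "connected_on E S"
proof -
  have "(y, z) \<in> (adj_in E S)\<^sup>*" if "y \<in> S" "z \<in> S" for y z
    using that assms(2) adj_rtrancl_sym rtrancl_trans by meson
  with assms(1) show ?thesis by (auto simp: connected_on_def)
qed

lemma connected_onD: "connected_on E S \<Longrightarrow> x \<in> S \<Longrightarrow> y \<in> S \<Longrightarrow> (x, y) \<in> (adj_in E S)\<^sup>*"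
  by (auto simp: connected_on_def)

lemma connected_on_Un:
  assumes "connected_on E A" "connected_on E B" "A \<inter> B \<noteq> {}"
  shows "connected_on E (A \<union> B)"
proof -
  obtain x where "x \<in> A" "x \<in> B" using assms by blast
  then show ?thesis
    by (intro connected_onI[of x])
      (use assms in \<open>auto intro: adj_rtrancl_mono[OF connected_onD]\<close>)
qed

lemma connected_on_complete:
  assumes "S \<noteq> {}" "\<And>x y. x \<in> S \<Longrightarrow> y \<in> S \<Longrightarrow> x \<noteq> y \<Longrightarrow> {x, y} \<in> E"
  shows "connected_on E S"
proof -
  obtain x where x: "x \<in> S" using assms by blast
  have "(x, y) \<in> (adj_in E S)\<^sup>*" if "y \<in> S" for y
    using x that assms(2)[OF x that] by (cases "x = y") (auto simp: adj_in_def)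
  with x show ?thesis by (rule connected_onI)
qed

lemma connected_on_walk:
  fixes w :: "nat \<Rightarrow> 'a"
  assumes "a \<le> b" "\<And>k. a \<le> k \<Longrightarrow> k < b \<Longrightarrow> {w k, w (Suc k)} \<in> E"
  shows "connected_on E (w ` {a..b})"
  using assms
proof (induction b rule: dec_induct)
  case base
  show ?case by (rule connected_on_complete) auto
next
  case (step b)
  have "connected_on E {w b, w (Suc b)}"
    using step by (intro connected_on_complete) (auto simp: insert_commute)
  with step have "connected_on E (w ` {a..b} \<union> {w b, w (Suc b)})"
    by (intro connected_on_Un) auto
  moreover have "w ` {a..b} \<union> {w b, w (Suc b)} = w ` {a..Suc b}"
    using step by (auto simp: atLeastAtMostSuc_conv)
  ultimately show ?case by simp
qed

text \<open>Connectedness of \<open>B\<close> sees only edges inside \<open>B\<close>, so it can be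
  moved between a graph and the subgraph induced on a component.\<close>

lemma connected_on_restrict: "B \<subseteq> C \<Longrightarrow> connected_on {e \<in> E. e \<subseteq> C} B = connected_on E B"
proof -
  assume "B \<subseteq> C"
  then have "adj_in {e \<in> E. e \<subseteq> C} B = adj_in E B" by (auto simp: adj_in_def)
  then show ?thesis by (simp add: connected_on_def)
qed

text \<open>Supplies components, blocks and an inclusion-maximal vertex set carrying a partial
  tree.\<close>

lemma ex_maximal_superset:
  assumes "finite V" "W \<subseteq> V" "P W"
  obtains B where "W \<subseteq> B" "B \<subseteq> V" "P B" "\<And>B'. B \<subset> B' \<Longrightarrow> B' \<subseteq> V \<Longrightarrow> \<not> P B'"
proof -
  have "finite {B. B \<subseteq> V \<and> P B}" using assms(1) by simp
  then obtain B where "B \<in> {B. B \<subseteq> V \<and> P B}" "W \<subseteq> B"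
    "\<And>B'. B' \<in> {B. B \<subseteq> V \<and> P B} \<Longrightarrow> B \<subseteq> B' \<Longrightarrow> B = B'"
    using finite_has_maximal2[of "{B. B \<subseteq> V \<and> P B}" W] assms by (metis (mono_tags, lifting) mem_Collect_eq)
  then show thesis by (intro that) auto
qed

text \<open>Steps run through triangles rather than edges, so that dropping \<open>T\<close> from
  \<open>\<T>\<close> describes walks that avoid the triangle \<open>T\<close>.\<close>

definition joined :: "'a set set \<Rightarrow> ('a \<times> 'a) set" where
  "joined \<T> = {(x, y). \<exists>T\<in>\<T>. x \<in> T \<and> y \<in> T}"

text \<open>A walk of least length is injective: between two visits of a vertex it could be
  shortened.\<close>

lemma rtrancl_injective_walk:
  assumes "(x, y) \<in> R\<^sup>*"
  obtains w :: "nat \<Rightarrow> 'a" and n where "w 0 = x" "w n = y" "\<And>k. k < n \<Longrightarrow> (w k, w (Suc k)) \<in> R" "inj_on w {..n}"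
proof -
  define n where "n = (LEAST n. (x, y) \<in> R ^^ n)"
  have n: "(x, y) \<in> R ^^ n" unfolding n_def using assms by (metis LeastI_ex rtrancl_imp_relpow)
  have least: "n \<le> m" if "(x, y) \<in> R ^^ m" for m unfolding n_def using that by (rule Least_le)
  from n obtain w where w: "w 0 = x" "w n = y" "\<And>k. k < n \<Longrightarrow> (w k, w (Suc k)) \<in> R"
    by (auto simp: relpow_fun_conv)
  have "w k \<noteq> w l" if "k < l" "l \<le> n" for k l
  proof
    assume eq: "w k = w l"
    have "(w 0, w k) \<in> R ^^ k" using w that by (auto simp: relpow_fun_conv intro!: exI[of _ w])
    moreover have "(w l, w n) \<in> R ^^ (n - l)"
      using w that by (auto simp: relpow_fun_conv intro!: exI[of _ "\<lambda>i. w (l + i)"])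
    ultimately have "(x, y) \<in> R ^^ (k + (n - l))" using eq w by (auto simp: relpow_add)
    with least that show False by fastforce
  qed
  then have "inj_on w {..n}" by (intro linorder_inj_onI) auto
  with w that show thesis by blast
qed

text \<open>A walk joining two vertices of a triangle through other triangles would form with it a
  subgraph without cut vertex that is too large for a block.\<close>

lemma not_joined_by_others:
  assumes gr: "graph V E" and good: "good_triangle_set V E \<T>" and T: "T \<in> \<T>"
    and xy: "x \<in> T" "y \<in> T" "x \<noteq> y"
  shows "(x, y) \<notin> (joined (\<T> - {T}))\<^sup>*"
proof
  assume "(x, y) \<in> (joined (\<T> - {T}))\<^sup>*"
  then obtain w :: "nat \<Rightarrow> 'a" and n where w: "w 0 = x" "w n = y" "inj_on w {..n}"
    "\<And>k. k < n \<Longrightarrow> (w k, w (Suc k)) \<in> joined (\<T> - {T})"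
    by (elim rtrancl_injective_walk) blast
  define F where "F = \<Union>(tri_edges ` \<T>)"
  have tri: "is_triangle V E T'" if "T' \<in> \<T>" for T' using good that by (simp add: good_triangle_set_def)
  have disj: "tri_edges T1 \<inter> tri_edges T2 = {}" if "T1 \<in> \<T>" "T2 \<in> \<T>" "T1 \<noteq> T2" for T1 T2
    using good that by (simp add: good_triangle_set_def)
  have forest: "triangle_forest (\<Union>F) F" using good by (simp add: good_triangle_set_def F_def)
  have FI: "{a, b} \<in> tri_edges T'" "{a, b} \<in> F" if "T' \<in> \<T>" "a \<in> T'" "b \<in> T'" "a \<noteq> b" for a b T'
    using that by (auto simp: F_def tri_edges_def)
  have "\<Union>F \<subseteq> V" using tri by (fastforce simp: F_def tri_edges_def is_triangle_def)
  then have finF: "finite (\<Union>F)" using gr finite_subset by (auto simp: graph_def)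
  have n0: "n > 0" using w xy by (cases n) auto
  have wne: "w k \<noteq> w l" if "k < l" "l \<le> n" for k l using w(3) that by (auto simp: inj_on_def)
  have wT: "\<exists>T'\<in>\<T>. T' \<noteq> T \<and> w k \<in> T' \<and> w (Suc k) \<in> T'" if "k < n" for k
    using w(4)[OF that] by (auto simp: joined_def)
  have wF: "{w k, w (Suc k)} \<in> F" if "k < n" for k
    using wT[OF that] FI wne[of k "Suc k"] that by auto
  have cardT: "card T = 3" using tri[OF T] by (simp add: is_triangle_def)
  have conT: "connected_on F A" if "A \<subseteq> T" "A \<noteq> {}" for A
    using that FI(2)[OF T] by (intro connected_on_complete; blast)
  define W where "W = T \<union> w ` {0..n}"
  have conW: "connected_on F W"
    unfolding W_def using wF w xy conT[of T]
    by (intro connected_on_Un connected_on_walk) (auto intro!: exI[of _ x] image_eqI[of _ _ 0])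
  have cutW: "no_cut_vertex F W"
    unfolding no_cut_vertex_def
  proof (intro ballI disjI2)
    fix z assume z: "z \<in> W"
    have "T - {z} \<noteq> {}" using xy by auto
    then have Tz: "connected_on F (T - {z})" by (intro conT) auto
    show "connected_on F (W - {z})"
    proof (cases "z \<in> w ` {0..n}")
      case False
      have "connected_on F ((T - {z}) \<union> w ` {0..n})"
        using wF w xy Tz False
        by (intro connected_on_Un connected_on_walk) (auto intro!: exI[of _ x] image_eqI[of _ _ 0])
      moreover have "W - {z} = (T - {z}) \<union> w ` {0..n}" using False by (auto simp: W_def)
      ultimately show ?thesis by simp
    next
      case True
      then obtain i where i: "i \<le> n" "z = w i" by auto
      \<comment> \<open>Deleting \<open>w i\<close> splits the walk into a front part attached to
        the triangle at \<open>x\<close> and a rear part attached at \<open>y\<close>. The case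
        \<open>i = 0\<close> is separate because truncated subtraction would turn
        \<open>{0..i - 1}\<close> into \<open>{0}\<close>.\<close>
      define A where "A = T - {z} \<union> (if i = 0 then {} else w ` {0..i - 1})"
      have A: "connected_on F A"
      proof (cases "i = 0")
        case False
        have "x \<in> T - {z}" "x \<in> w ` {0..i - 1}"
          using wne[of 0 i] w xy i False by (auto intro: image_eqI[of _ _ 0])
        then have "connected_on F (T - {z} \<union> w ` {0..i - 1})"
          using wF Tz i False by (intro connected_on_Un connected_on_walk) auto
        then show ?thesis using False by (simp add: A_def)
      qed (use Tz in \<open>simp add: A_def\<close>)
      define B where "B = A \<union> (if i = n then {} else w ` {Suc i..n})"
      have "connected_on F B"
      proof (cases "i = n")
        case False
        have "y \<in> A" "y \<in> w ` {Suc i..n}"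
          using wne[of i n] w xy i False by (auto simp: A_def intro: image_eqI[of _ _ n])
        then have "connected_on F (A \<union> w ` {Suc i..n})"
          using wF A i False by (intro connected_on_Un connected_on_walk) auto
        then show ?thesis using False by (simp add: B_def)
      qed (use A in \<open>simp add: B_def\<close>)
      moreover have "W - {z} = B"
      proof -
        have "w ` {0..n} - {w i} = w ` ({0..n} - {i})"
          using w(3) i by (subst inj_on_image_set_diff[of w "{..n}"]) auto
        also have "{0..n} - {i} = (if i = 0 then {} else {0..i - 1}) \<union> (if i = n then {} else {Suc i..n})"
          using i by auto
        finally have "w ` {0..n} - {z} =
          (if i = 0 then {} else w ` {0..i - 1}) \<union> (if i = n then {} else w ` {Suc i..n})"
          using i(2) by (simp add: image_Un)
        moreover have "W - {z} = (T - {z}) \<union> (w ` {0..n} - {z})" by (auto simp: W_def)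
        ultimately show ?thesis by (simp only: A_def B_def Un_assoc)
      qed
      ultimately show ?thesis by simp
    qed
  qed
  have WF: "W \<subseteq> \<Union>F"
  proof -
    have "a \<in> \<Union>F" if "a \<in> T" for a using FI(2)[OF T that, of x] FI(2)[OF T that, of y] xy that T by blast
    moreover have "w k \<in> \<Union>F" if "k \<le> n" for k
    proof (cases "k < n")
      case True
      then show ?thesis using wF by blast
    next
      case False
      then have "{w (k - 1), w k} \<in> F" using wF[of "k - 1"] n0 that by auto
      then show ?thesis by blast
    qed
    ultimately show ?thesis by (auto simp: W_def)
  qed
  \<comment> \<open>\<open>W\<close> lies in a component and there in a block, which by the forest
    condition has three vertices.\<close>
  obtain C where C: "W \<subseteq> C" "C \<subseteq> \<Union>F" "connected_on F C"
    "\<And>C'. C \<subset> C' \<Longrightarrow> C' \<subseteq> \<Union>F \<Longrightarrow> \<not> connected_on F C'"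
    using ex_maximal_superset[of "\<Union>F" W "connected_on F"] finF WF conW by metis
  define FC where "FC = {e \<in> F. e \<subseteq> C}"
  have "triangle_tree C FC"
    using forest C unfolding triangle_forest_def is_component_def FC_def by blast
  then have blk: "is_triangle C FC B" if "is_block C FC B" for B using that by (simp add: triangle_tree_def)
  have FC: "connected_on FC B = connected_on F B" if "B \<subseteq> C" for B
    unfolding FC_def using that by (rule connected_on_restrict)
  have "connected_on FC (W - {z}) = connected_on F (W - {z})" for z
    using C(1) by (intro FC) auto
  then have "connected_on FC W \<and> no_cut_vertex FC W"
    using FC[OF C(1)] conW cutW by (simp add: no_cut_vertex_def)
  moreover have "finite C" using C finF finite_subset by blast
  ultimately obtain B where B: "W \<subseteq> B" "B \<subseteq> C" "connected_on FC B \<and> no_cut_vertex FC B"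
    "\<And>B'. B \<subset> B' \<Longrightarrow> B' \<subseteq> C \<Longrightarrow> \<not> (connected_on FC B' \<and> no_cut_vertex FC B')"
    using ex_maximal_superset[of C W "\<lambda>B. connected_on FC B \<and> no_cut_vertex FC B"] C(1) by metis
  then have "is_block C FC B" unfolding is_block_def by blast
  from blk[OF this] have "card B = 3" by (simp add: is_triangle_def)
  moreover have "T \<subseteq> B" using B by (auto simp: W_def)
  \<comment> \<open>Now the first step of the walk joins two vertices of \<open>T\<close>, and the
    other triangle containing this step shares an edge with \<open>T\<close>, against
    edge-disjointness.\<close>
  ultimately have "T = B" using cardT by (metis card_subset_eq card.infinite zero_neq_numeral)
  then have "w 1 \<in> T" using B(1) n0 by (auto simp: W_def)
  moreover obtain T' where "T' \<in> \<T>" "T' \<noteq> T" "w 0 \<in> T'" "w 1 \<in> T'" using wT[of 0] n0 by auto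
  moreover have "w 0 \<noteq> w 1" using wne[of 0 1] n0 by auto
  ultimately show False using disj[of T T'] FI(1)[of T "w 0" "w 1"] FI(1)[of T' "w 0" "w 1"] T w xy by auto
qed

lemma joined_rtrancl_sym: "(x, y) \<in> (joined \<T>)\<^sup>* \<Longrightarrow> (y, x) \<in> (joined \<T>)\<^sup>*"
proof -
  have "sym (joined \<T>)" by (auto simp: sym_def joined_def)
  then show "(x, y) \<in> (joined \<T>)\<^sup>* \<Longrightarrow> (y, x) \<in> (joined \<T>)\<^sup>*"
    using sym_rtrancl by (metis symD)
qed

lemma joined_rtrancl_mono: "(x, y) \<in> (joined D)\<^sup>* \<Longrightarrow> D \<subseteq> D' \<Longrightarrow> (x, y) \<in> (joined D')\<^sup>*"
  by (rule subsetD[OF rtrancl_mono]) (auto simp: joined_def)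

section \<open>Growing a sibling tree by leaves and by triangles\<close>

context sibling_tree
begin

lemma C_subset: "C \<subseteq> V"
  using sibling by blast

lemma add_leaf:
  assumes "p \<in> V" "v \<notin> V" "{v, p} \<in> E"
  shows "sibling_tree (insert v V) E r (par(v := p)) (dep(v := Suc (dep p))) C bb"
proof
  fix c assume c: "c \<in> C"
  with sibling[OF c] assms(2) have "c \<noteq> v" "bb c \<noteq> v" by auto
  with sibling[OF c] show "c \<in> insert v V \<and> bb c \<in> insert v V \<and> bb c \<notin> C \<and>
    0 < (dep(v := Suc (dep p))) c \<and> 0 < (dep(v := Suc (dep p))) (bb c) \<and>
    (par(v := p)) (bb c) = (par(v := p)) c \<and> {c, bb c} \<in> E"
    by simp
next
  fix x assume x: "x \<in> insert v V" "0 < (dep(v := Suc (dep p))) x"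
  have "p \<noteq> v" using assms by auto
  moreover have "par x \<noteq> v" if "x \<noteq> v" using parent[of x] x assms that by auto
  ultimately show "(par(v := p)) x \<in> insert v V \<and> {x, (par(v := p)) x} \<in> E \<and>
    (dep(v := Suc (dep p))) x = Suc ((dep(v := Suc (dep p))) ((par(v := p)) x))"
    using x assms parent[of x] by auto
qed (use root inj_bb in \<open>auto split: if_splits\<close>)

text \<open>How a chosen triangle enters the tree: \<open>p\<close> is already there, the other two
  vertices become its children, and \<open>c\<close> joins \<open>C\<close>, which accounts for one
  saved colour.\<close>

lemma add_sibling_pair:
  assumes p: "p \<in> V" and new: "b \<notin> V" "c \<notin> V" "b \<noteq> c" and E: "{b, p} \<in> E" "{c, p} \<in> E" "{c, b} \<in> E"
  shows "sibling_tree (insert c (insert b V)) E r (par(b := p, c := p))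
    (dep(b := Suc (dep p), c := Suc (dep p))) (insert c C) (bb(c := b))"
proof -
  interpret B: sibling_tree "insert b V" E r "par(b := p)" "dep(b := Suc (dep p))" C bb
    using p new E by (intro add_leaf) auto
  have pb: "(dep(b := Suc (dep p))) p = dep p" using p new by auto
  interpret S: sibling_tree "insert c (insert b V)" E r "par(b := p, c := p)"
      "dep(b := Suc (dep p), c := Suc (dep p))" C bb
    using B.add_leaf[of p c] p new E unfolding pb by auto
  have bbV: "x \<in> V \<and> bb x \<in> V" if "x \<in> C" for x using sibling[OF that] by simp
  show ?thesis
  proof
    show "inj_on (bb(c := b)) (insert c C)"
      using inj_bb bbV new by (auto simp: inj_on_def)
  next
    fix x assume x: "x \<in> insert c C"
    show "x \<in> insert c (insert b V) \<and> (bb(c := b)) x \<in> insert c (insert b V) \<and>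
      (bb(c := b)) x \<notin> insert c C \<and> 0 < (dep(b := Suc (dep p), c := Suc (dep p))) x \<and>
      0 < (dep(b := Suc (dep p), c := Suc (dep p))) ((bb(c := b)) x) \<and>
      (par(b := p, c := p)) ((bb(c := b)) x) = (par(b := p, c := p)) x \<and> {x, (bb(c := b)) x} \<in> E"
    proof (cases "x = c")
      case True
      then show ?thesis using new E bbV by auto
    next
      case False
      then have "x \<in> C" using x by simp
      with False S.sibling[of x] bbV[of x] new show ?thesis by auto
    qed
  qed (use S.root S.parent in auto)
qed

end

text \<open>For an inclusion-maximal partial tree, maximality first excludes remaining triangles
  that meet it, then remaining vertices; hence no triangle remains.\<close>

lemma ex_sibling_tree:
  assumes con: "connected_graph V E" and good: "good_triangle_set V E \<T>"
  shows "\<exists>r par dep C bb. sibling_tree V E r par dep C bb \<and> card C = card \<T>"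
proof -
  have gr: "graph V E" and conV: "connected_on E V" using con by (auto simp: connected_graph_def)
  have finV: "finite V" using gr by (simp add: graph_def)
  have tri: "T \<subseteq> V" "card T = 3" "\<And>u v. u \<in> T \<Longrightarrow> v \<in> T \<Longrightarrow> u \<noteq> v \<Longrightarrow> {u, v} \<in> E" if "T \<in> \<T>" for T
    using good that by (auto simp: good_triangle_set_def is_triangle_def)
  have finT: "finite \<T>" using tri(1) finV by (auto intro: finite_subset[of _ "Pow V"])
  obtain r where r: "r \<in> V" using conV by (auto simp: connected_on_def)
  \<comment> \<open>\<open>D\<close> holds the triangles already absorbed. The last clause is the
    essential invariant: vertices of \<open>S\<close> linked through triangles of
    \<open>\<T>\<close> are already linked through triangles of \<open>D\<close>.\<close>
  define grown where "grown S \<longleftrightarrow> (\<exists>par dep C bb D. sibling_tree S E r par dep C bb \<and> D \<subseteq> \<T> \<and>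
    \<Union>D \<subseteq> S \<and> card C = card D \<and>
    (\<forall>x\<in>S. \<forall>y\<in>S. (x, y) \<in> (joined \<T>)\<^sup>* \<longrightarrow> (x, y) \<in> (joined D)\<^sup>*))" for S
  have grownI: "grown S'"
    if "sibling_tree S' E r par dep C bb" "D \<subseteq> \<T>" "\<Union>D \<subseteq> S'" "card C = card D"
      "\<And>x y. x \<in> S' \<Longrightarrow> y \<in> S' \<Longrightarrow> (x, y) \<in> (joined \<T>)\<^sup>* \<Longrightarrow> (x, y) \<in> (joined D)\<^sup>*"
    for S' par dep C bb D
    unfolding grown_def
    by (intro exI conjI ballI impI, rule that(1), rule that(2), rule that(3), rule that(4), rule that(5))
  have "sibling_tree {r} E r id (\<lambda>_. 0) {} id" by unfold_locales auto
  then have "grown {r}" by (rule grownI[where D = "{}"]) auto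
  then obtain S where rS: "r \<in> S" and SV: "S \<subseteq> V" and "grown S"
    and max: "\<And>S'. S \<subset> S' \<Longrightarrow> S' \<subseteq> V \<Longrightarrow> \<not> grown S'"
    using ex_maximal_superset[of V "{r}" grown] finV r by (metis empty_subsetI insert_subset)
  then obtain par dep C bb D where tree: "sibling_tree S E r par dep C bb" and D: "D \<subseteq> \<T>" "\<Union>D \<subseteq> S"
    and card: "card C = card D"
    and jn: "\<And>x y. x \<in> S \<Longrightarrow> y \<in> S \<Longrightarrow> (x, y) \<in> (joined \<T>)\<^sup>* \<Longrightarrow> (x, y) \<in> (joined D)\<^sup>*"
  proof -
    from \<open>grown S\<close> obtain par dep C bb D where *: "sibling_tree S E r par dep C bb" "D \<subseteq> \<T>" "\<Union>D \<subseteq> S"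
      "card C = card D" "\<forall>x\<in>S. \<forall>y\<in>S. (x, y) \<in> (joined \<T>)\<^sup>* \<longrightarrow> (x, y) \<in> (joined D)\<^sup>*"
      unfolding grown_def by (elim exE conjE) (rule that)
    show thesis by (rule that[OF *(1-4)]) (use *(5) in blast)
  qed
  interpret sibling_tree S E r par dep C bb by (rule tree)
  \<comment> \<open>By the invariant, two vertices of an unabsorbed triangle in \<open>S\<close>
    would be linked through \<open>D\<close>, hence without \<open>T\<close>.\<close>
  have one: "x = y" if "T \<in> \<T>" "T \<notin> D" "x \<in> T" "y \<in> T" "x \<in> S" "y \<in> S" for T x y
  proof (rule ccontr)
    assume "x \<noteq> y"
    have "(x, y) \<in> joined \<T>" using that by (auto simp: joined_def)
    then have "(x, y) \<in> (joined D)\<^sup>*" using jn that by blast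
    then have "(x, y) \<in> (joined (\<T> - {T}))\<^sup>*" by (rule joined_rtrancl_mono) (use D that in auto)
    with not_joined_by_others[OF gr good that(1,3,4) \<open>x \<noteq> y\<close>] show False ..
  qed
  \<comment> \<open>A single shared vertex \<open>p\<close> could become the parent of the other
    two, which would enlarge \<open>S\<close>.\<close>
  have apart: "T \<inter> S = {}" if T: "T \<in> \<T>" "T \<notin> D" for T
  proof (rule ccontr)
    assume "T \<inter> S \<noteq> {}"
    then obtain p where p: "p \<in> T" "p \<in> S" by auto
    have "card (T - {p}) = 2" using tri(2)[OF T(1)] p by simp
    then obtain b c where bc: "T - {p} = {b, c}" "b \<noteq> c" by (meson card_2_iff)
    then have Tbc: "T = insert c (insert b {p})" "b \<noteq> p" "c \<noteq> p" using p by auto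
    then have new: "b \<notin> S" "c \<notin> S" using one[OF T p(1) _ p(2)] by blast+
    let ?S = "insert c (insert b S)"
    have tree': "sibling_tree ?S E r (par(b := p, c := p)) (dep(b := Suc (dep p), c := Suc (dep p)))
      (insert c C) (bb(c := b))"
      using p new bc(2) tri(3)[OF T(1)] Tbc by (intro add_sibling_pair) auto
    have card': "card (insert c C) = card (insert T D)"
    proof -
      have "finite C" "finite D" "c \<notin> C" using C_subset SV finV finT D new by (auto intro: finite_subset)
      then show ?thesis using card T by simp
    qed
    have jn': "(x, y) \<in> (joined (insert T D))\<^sup>*"
      if xy: "x \<in> ?S" "y \<in> ?S" "(x, y) \<in> (joined \<T>)\<^sup>*" for x y
    proof -
      \<comment> \<open>The new vertices are linked to \<open>p\<close> through \<open>T\<close>, so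
        the invariant on \<open>?S\<close> reduces to the one on \<open>S\<close>.\<close>
      have near: "\<exists>z'\<in>S. (z, z') \<in> (joined (insert T D))\<^sup>*" if "z \<in> ?S" for z
      proof (cases "z \<in> S")
        case False
        then have "(z, p) \<in> joined (insert T D)" using that Tbc p by (auto simp: joined_def)
        with p show ?thesis by blast
      qed blast
      obtain x' y' where x': "x' \<in> S" "(x, x') \<in> (joined (insert T D))\<^sup>*"
        and y': "y' \<in> S" "(y, y') \<in> (joined (insert T D))\<^sup>*"
        using near xy by meson
      have sub: "insert T D \<subseteq> \<T>" "D \<subseteq> insert T D" using T D by auto
      have "(x', x) \<in> (joined \<T>)\<^sup>*"
        by (rule joined_rtrancl_mono[OF joined_rtrancl_sym[OF x'(2)] sub(1)])
      also note xy(3)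
      also have "(y, y') \<in> (joined \<T>)\<^sup>*" by (rule joined_rtrancl_mono[OF y'(2) sub(1)])
      finally have "(x', y') \<in> (joined D)\<^sup>*" by (rule jn[OF x'(1) y'(1)])
      note x'(2)
      also have "(x', y') \<in> (joined (insert T D))\<^sup>*" by (rule joined_rtrancl_mono[OF _ sub(2)]) fact
      also have "(y', y) \<in> (joined (insert T D))\<^sup>*" by (rule joined_rtrancl_sym[OF y'(2)])
      finally show ?thesis .
    qed
    have D': "insert T D \<subseteq> \<T>" "\<Union>(insert T D) \<subseteq> ?S" using T D Tbc p by auto
    from tree' D' card' jn' have "grown ?S" by (rule grownI)
    moreover have "S \<subset> ?S" "?S \<subseteq> V" using new SV tri(1)[OF T(1)] Tbc by auto
    ultimately show False using max by blast
  qed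
  have "S = V"
  proof (rule ccontr)
    assume "S \<noteq> V"
    then obtain z where z: "z \<in> V" "z \<notin> S" using SV by auto
    have "(r, z) \<in> (adj_in E V)\<^sup>*" using connected_onD[OF conV r z(1)] .
    then have "\<exists>p v. p \<in> S \<and> v \<notin> S \<and> (p, v) \<in> adj_in E V"
      using rS z(2) by (induction rule: rtrancl_induct) blast+
    then obtain p v where pv: "p \<in> S" "v \<notin> S" "v \<in> V" "{v, p} \<in> E"
      by (auto simp: adj_in_def insert_commute)
    \<comment> \<open>Every triangle meeting \<open>S\<close> lies inside \<open>S\<close>, so a new
      leaf is linked to no vertex of \<open>S\<close> and the invariant survives.\<close>
    have closed: "y \<in> S" if "(x, y) \<in> (joined \<T>)\<^sup>*" "x \<in> S" for x y
      using that
    proof (induction rule: rtrancl_induct)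
      case (step y z)
      then obtain T where "T \<in> \<T>" "y \<in> T" "z \<in> T" "y \<in> S" by (auto simp: joined_def)
      with apart[of T] D(2) show ?case by blast
    qed
    have "(x, y) \<in> (joined D)\<^sup>*" if "x \<in> insert v S" "y \<in> insert v S" "(x, y) \<in> (joined \<T>)\<^sup>*" for x y
    proof (cases "x = y")
      case False
      then have "x \<in> S \<or> y \<in> S" using that by auto
      then have "x \<in> S" "y \<in> S"
        using closed[OF that(3)] closed[OF joined_rtrancl_sym[OF that(3)]] by auto
      then show ?thesis using jn that(3) by simp
    qed simp
    with add_leaf[OF pv(1,2,4)] D(1) _ card have "grown (insert v S)"
      by (rule grownI) (use D(2) in auto)
    with max[of "insert v S"] pv SV show False by auto
  qed
  have "D = \<T>"
  proof (rule ccontr)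
    assume "D \<noteq> \<T>"
    then obtain T where T: "T \<in> \<T>" "T \<notin> D" using D by auto
    then have "T = {}" using apart tri(1) \<open>S = V\<close> by blast
    with tri(2)[OF T(1)] show False by simp
  qed
  with tree card \<open>S = V\<close> show ?thesis by blast
qed

text \<open>The inequality makes the natural subtraction \<open>n2 V E - card \<T>\<close>
  exact.\<close>

lemma ex_rainbow_colouring:
  assumes con: "connected_graph V E" and good: "good_triangle_set V E \<T>"
  shows "card \<T> \<le> n2 V E"
    and "\<exists>c. (\<forall>X\<in>line_graph_edges E. c X < n2 V E - card \<T>) \<and> rainbow_connected E (line_graph_edges E) c"
proof -
  have gr: "graph V E" using con by (simp add: connected_graph_def)
  obtain r par dep C bb where "sibling_tree V E r par dep C bb" and card: "card C = card \<T>"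
    using ex_sibling_tree[OF assms] by blast
  then interpret sibling_tree V E r par dep C bb by simp
  have sub: "C \<subseteq> {v \<in> V. degree E v \<ge> 2}" using C_subset sib_deg[OF gr] by auto
  have fin: "finite {v \<in> V. degree E v \<ge> 2}" using gr by (simp add: graph_def)
  show "card \<T> \<le> n2 V E" unfolding n2_def card[symmetric] using sub fin by (rule card_mono[rotated])
  show "\<exists>c. (\<forall>X\<in>line_graph_edges E. c X < n2 V E - card \<T>) \<and> rainbow_connected E (line_graph_edges E) c"
    using rainbow_colouring[OF gr] sub fin
    by (simp add: n2_def card[symmetric] card_Diff_subset finite_subset)
qed

section \<open>A family attaining the bound\<close>

lemma length_path_edges_ge:
  fixes \<mu> :: "'v \<Rightarrow> nat"
  assumes "ps \<noteq> []" "set (path_edges ps) \<subseteq> F" "\<And>a b. {a, b} \<in> F \<Longrightarrow> \<mu> b \<le> \<mu> a + 1"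
  shows "\<mu> (last ps) \<le> \<mu> (hd ps) + length (path_edges ps)"
  using assms(1,2)
proof (induction ps rule: induct_list012)
  case (3 a b ps)
  then have "\<mu> b \<le> \<mu> a + 1" using assms(3) by (simp add: path_edges_def)
  with 3 show ?case by (simp add: path_edges_def)
qed auto

text \<open>The minimum of \<open>\<phi>\<close> over an edge grows by at most 1 per step in the
  line graph, and a rainbow path has no more edges than there are colours. The assumption
  \<open>ex\<close> ensures that the \<open>LEAST\<close> in \<open>rc\<close> is attained.\<close>

lemma rc_line_ge:
  fixes \<phi> :: "'a \<Rightarrow> nat"
  assumes gr: "graph V E" and ex: "\<exists>k c. (\<forall>X\<in>line_graph_edges E. c X < k) \<and> rainbow_connected E (line_graph_edges E) c"
    and lip: "\<And>h x y. h \<in> E \<Longrightarrow> x \<in> h \<Longrightarrow> y \<in> h \<Longrightarrow> \<phi> y \<le> \<phi> x + 1"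
    and e: "e \<in> E" and f: "f \<in> E"
  shows "Min (\<phi> ` f) \<le> Min (\<phi> ` e) + rc_line V E"
proof -
  let ?k = "rc_line V E"
  obtain c where c: "\<forall>X\<in>line_graph_edges E. c X < ?k" "rainbow_connected E (line_graph_edges E) c"
    using LeastI_ex[OF ex] unfolding rc_line_def rc_def by blast
  then obtain ps where ps: "is_path (line_graph_edges E) ps e f" "distinct (map c (path_edges ps))"
    using e f unfolding rainbow_connected_def by blast
  have step: "Min (\<phi> ` b) \<le> Min (\<phi> ` a) + 1" if "{a, b} \<in> line_graph_edges E" for a b
  proof -
    have ab: "a \<in> E" "b \<in> E" "a \<inter> b \<noteq> {}" using that by (auto simp: line_graph_edges_def doubleton_eq_iff)
    then obtain v where v: "v \<in> a" "v \<in> b" by auto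
    have fin: "finite a" "finite b" using ab gr by (auto simp: graph_def intro: finite_subset)
    then have "Min (\<phi> ` a) \<in> \<phi> ` a" using v by (intro Min_in) auto
    then obtain x where "x \<in> a" "\<phi> x = Min (\<phi> ` a)" by auto
    then have "\<phi> v \<le> Min (\<phi> ` a) + 1" using lip[OF ab(1) _ v(1)] by metis
    moreover have "Min (\<phi> ` b) \<le> \<phi> v" using fin v by simp
    ultimately show ?thesis by simp
  qed
  have sub: "set (path_edges ps) \<subseteq> line_graph_edges E" using ps by (simp add: is_path_def)
  have "Min (\<phi> ` f) \<le> Min (\<phi> ` e) + length (path_edges ps)"
    using length_path_edges_ge[of ps "line_graph_edges E" "\<lambda>h. Min (\<phi> ` h)"] step ps(1)
    by (auto simp: is_path_def)
  also have "length (path_edges ps) = card (c ` set (path_edges ps))"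
    using distinct_card[OF ps(2)] by simp
  also have "\<dots> \<le> card {..<?k}" using sub c(1) by (intro card_mono) auto
  finally show ?thesis by simp
qed

text \<open>Each component is a single triangle. All its nonempty subsets are connected, so it has
  no cut vertex and is its own sole block.\<close>

lemma triangle_forest_disjoint:
  assumes disj: "\<And>T1 T2. T1 \<in> \<T> \<Longrightarrow> T2 \<in> \<T> \<Longrightarrow> T1 \<noteq> T2 \<Longrightarrow> T1 \<inter> T2 = {}"
    and card: "\<And>T. T \<in> \<T> \<Longrightarrow> card T = 3"
  shows "triangle_forest (\<Union>(\<Union>(tri_edges ` \<T>))) (\<Union>(tri_edges ` \<T>))"
  unfolding triangle_forest_def
proof (intro allI impI)
  define F where "F = \<Union>(tri_edges ` \<T>)"
  fix C assume "is_component (\<Union>(\<Union>(tri_edges ` \<T>))) (\<Union>(tri_edges ` \<T>)) C"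
  then have C: "C \<subseteq> \<Union>F" "connected_on F C" "\<And>C'. C \<subset> C' \<Longrightarrow> C' \<subseteq> \<Union>F \<Longrightarrow> \<not> connected_on F C'"
    by (auto simp: is_component_def F_def)
  obtain x where x: "x \<in> C" using C(2) by (auto simp: connected_on_def)
  then obtain T where T: "T \<in> \<T>" "x \<in> T" using C(1) by (fastforce simp: F_def tri_edges_def)
  have "y \<in> T" if "y \<in> C" for y
    using connected_onD[OF C(2) x that]
  proof (induction rule: rtrancl_induct)
    case (step y z)
    then obtain T' where "T' \<in> \<T>" "y \<in> T'" "z \<in> T'" by (auto simp: adj_in_def F_def tri_edges_def)
    with step disj[OF T(1), of T'] show ?case by blast
  qed (use T in simp)
  then have CT: "C \<subseteq> T" by blast
  have FT: "{a, b} \<in> F" if "a \<in> T" "b \<in> T" "a \<noteq> b" for a b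
    using that T by (auto simp: F_def tri_edges_def)
  have "T \<subseteq> \<Union>F"
  proof
    fix a assume a: "a \<in> T"
    obtain b where "b \<in> T" "b \<noteq> a"
      using card[OF T(1)] by (metis card_1_singleton_iff is_singletonI' is_singleton_altdef numeral_eq_one_iff
        a empty_iff num.distinct(3) numeral_3_eq_3)
    with FT[OF a] show "a \<in> \<Union>F" by blast
  qed
  moreover have conT: "connected_on F A" if "A \<subseteq> T" "A \<noteq> {}" for A
    using that FT by (intro connected_on_complete; blast)
  ultimately have "C = T" using C(3)[of T] CT T(2) by blast
  define FC where "FC = {e \<in> F. e \<subseteq> C}"
  have conC: "connected_on FC A" if "A \<subseteq> C" "A \<noteq> {}" for A
    using conT connected_on_restrict[OF that(1), of F] that \<open>C = T\<close> by (simp add: FC_def)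
  have "no_cut_vertex FC C" unfolding no_cut_vertex_def using conC by (metis Diff_subset)
  then have "B = C" if "is_block C FC B" for B
    using that conC[of C] x unfolding is_block_def by (metis empty_iff order_refl psubsetI)
  moreover have "is_triangle C FC C"
    using card[OF T(1)] FT \<open>C = T\<close> by (auto simp: is_triangle_def FC_def)
  ultimately show "triangle_tree C {e \<in> \<Union>(tri_edges ` \<T>). e \<subseteq> C}"
    unfolding triangle_tree_def F_def[symmetric] FC_def[symmetric] using conC[of C] x by auto
qed

section \<open>Sharpness on a chain of triangles\<close>

lemma bound_attained:
  fixes t :: nat
  assumes "t > 0"
  shows "\<exists>(V :: nat set) E \<T>. connected_graph V E \<and> good_triangle_set V E \<T> \<and> card \<T> = t \<and>
    int (rc_line V E) = int (n2 V E) - int t"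
proof -
  \<comment> \<open>A path through \<open>0\<close>, ..., \<open>3 * t + 1\<close> with chords
    \<open>{3 * i + 1, 3 * i + 3}\<close> closing the triangles. Its first and last edges are
    pendant; the edges \<open>{3 * i + 3, 3 * i + 4}\<close> with \<open>i + 1 < t\<close> are the
    bridges.\<close>
  define V where "V = {0..3 * t + 1}"
  define E where "E = (\<lambda>k. {k, k + 1}) ` {0..3 * t} \<union> (\<lambda>i. {3 * i + 1, 3 * i + 3}) ` {..<t}"
  define tr where "tr i = {3 * i + 1, 3 * i + 2, 3 * i + 3}" for i :: nat
  define \<T> where "\<T> = tr ` {..<t}"
  have gr: "graph V E" by (auto simp: graph_def V_def E_def)
  have "connected_on E V"
    using connected_on_walk[of 0 "3 * t + 1" "\<lambda>k. k" E] by (auto simp: V_def E_def)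
  with gr have con: "connected_graph V E" by (simp add: connected_graph_def)
  have tr_disj: "tr i \<inter> tr j = {}" if "i \<noteq> j" for i j using that by (auto simp: tr_def; presburger)
  have card3: "card (tr i) = 3" for i by (simp add: tr_def)
  have "inj tr" using tr_disj card3 by (metis card.empty inf.idem injI zero_neq_numeral)
  then have cardT: "card \<T> = t" by (simp add: \<T>_def card_image inj_on_subset)
  have tri: "is_triangle V E (tr i)" if "i < t" for i
  proof -
    have "{3 * i + 1, 3 * i + 2} \<in> E" "{3 * i + 2, 3 * i + 3} \<in> E" "{3 * i + 1, 3 * i + 3} \<in> E"
      using that by (auto simp: E_def intro!: image_eqI[of _ _ "3 * i + 1"] image_eqI[of _ _ "3 * i + 2"])
    moreover have "tr i \<subseteq> V" using that by (auto simp: tr_def V_def)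
    ultimately show ?thesis using card3 by (auto simp: is_triangle_def tr_def insert_commute)
  qed
  have disj: "T1 \<inter> T2 = {}" if "T1 \<in> \<T>" "T2 \<in> \<T>" "T1 \<noteq> T2" for T1 T2
  proof -
    from that(1,2) obtain i j where ij: "T1 = tr i" "T2 = tr j" by (auto simp: \<T>_def)
    with \<open>T1 \<noteq> T2\<close> have "i \<noteq> j" by auto
    then show ?thesis unfolding ij by (rule tr_disj)
  qed
  have edge_disj: "tri_edges T1 \<inter> tri_edges T2 = {}" if "T1 \<in> \<T>" "T2 \<in> \<T>" "T1 \<noteq> T2" for T1 T2
  proof -
    have "h = {}" if "h \<subseteq> T1" "h \<subseteq> T2" for h
      using disj[OF \<open>T1 \<in> \<T>\<close> \<open>T2 \<in> \<T>\<close> \<open>T1 \<noteq> T2\<close>] that by blast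
    moreover have "card h = 2 \<Longrightarrow> h \<noteq> {}" for h :: "nat set" by auto
    ultimately show ?thesis unfolding tri_edges_def by blast
  qed
  have "triangle_forest (\<Union>(\<Union>(tri_edges ` \<T>))) (\<Union>(tri_edges ` \<T>))"
    by (rule triangle_forest_disjoint[OF disj]) (use card3 in \<open>auto simp: \<T>_def\<close>)
  with tri edge_disj have good: "good_triangle_set V E \<T>"
    unfolding good_triangle_set_def by (simp add: \<T>_def)
  note col = ex_rainbow_colouring[OF con good]
  have upper: "rc_line V E \<le> n2 V E - t"
    using col(2) unfolding rc_line_def rc_def cardT by (rule Least_le)
  have "n2 V E \<le> 3 * t"
  proof -
    have "{h \<in> E. 0 \<in> h} \<subseteq> {{0, 1}}" "{h \<in> E. 3 * t + 1 \<in> h} \<subseteq> {{3 * t, 3 * t + 1}}"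
      by (auto simp: E_def; presburger)+
    from this[THEN card_mono[rotated]] have deg: "degree E 0 \<le> 1" "degree E (3 * t + 1) \<le> 1"
      by (auto simp: degree_def)
    have "{v \<in> V. degree E v \<ge> 2} \<subseteq> {1..3 * t}"
    proof
      fix v assume v: "v \<in> {v \<in> V. degree E v \<ge> 2}"
      have "v \<noteq> 0 \<and> v \<noteq> 3 * t + 1"
      proof (intro conjI notI)
        assume "v = 0"
        with v deg(1) show False by simp
      next
        assume "v = 3 * t + 1"
        with v deg(2) show False by simp
      qed
      with v show "v \<in> {1..3 * t}" by (simp add: V_def)
    qed
    from card_mono[OF _ this] show ?thesis by (simp add: n2_def)
  qed
  moreover have "2 * t \<le> rc_line V E"
  proof -
    \<comment> \<open>a 1-Lipschitz lower bound for the distance from the vertex 0\<close>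
    define \<phi> :: "nat \<Rightarrow> nat" where "\<phi> k = (2 * k + 1) div 3" for k
    have "\<phi> y \<le> \<phi> x + 1" if "h \<in> E" "x \<in> h" "y \<in> h" for h x y
      using that by (auto simp: E_def \<phi>_def)
    moreover have "{0, 1} \<in> E" "{3 * t, 3 * t + 1} \<in> E" by (auto simp: E_def)
    \<comment> \<open>The minima are \<open>2 * t\<close> and \<open>0\<close>, as
      \<open>\<phi> (3 * t) = 2 * t\<close> and
      \<open>\<phi> (3 * t + 1) = 2 * t + 1\<close>.\<close>
    ultimately have "Min (\<phi> ` {3 * t, 3 * t + 1}) \<le> Min (\<phi> ` {0, 1}) + rc_line V E"
      using gr col(2) by (intro rc_line_ge) blast+
    then show ?thesis by (simp add: \<phi>_def)
  qed
  \<comment> \<open>The chain \<open>2 * t \<le> rc_line V E \<le> n2 V E - t \<le> 2 * t\<close>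
    forces equality.\<close>
  ultimately have "int (rc_line V E) = int (n2 V E) - int t" using upper col(1) cardT by linarith
  with con good cardT show ?thesis by blast
qed

theorem theorem3p1:
  shows "(\<forall>(V :: 'a set) E \<T> t. connected_graph V E \<and> good_triangle_set V E \<T> \<and> card \<T> = t
            \<longrightarrow> int (rc_line V E) \<le> int (n2 V E) - int t)
       \<and> (\<forall>t::nat. t > 0 \<longrightarrow> (\<exists>(V :: nat set) E \<T>. connected_graph V E \<and> good_triangle_set V E \<T>
            \<and> card \<T> = t \<and> int (rc_line V E) = int (n2 V E) - int t))"
proof -
  have "int (rc_line V E) \<le> int (n2 V E) - int (card \<T>)"
    if "connected_graph V E" "good_triangle_set V E \<T>" for V :: "'a set" and E \<T>
  proof -
    note col = ex_rainbow_colouring[OF that]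
    have "rc_line V E \<le> n2 V E - card \<T>"
      using col(2) unfolding rc_line_def rc_def by (rule Least_le)
    with col(1) show ?thesis by linarith
  qed
  then show ?thesis using bound_attained by blast
qed

end
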